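(* Let $A$ be a modal formula. If $A$ is valid on every $\mathbf{IL}_{\mathrm{set}}$-frame, then $\mathbf{IL}\vdash A$.
   Context: Modal formulas are built from $\bot$ and countably many propositional variables using $\rightarrow$, the unary modality $\Box$ and the binary modality $\rhd$; other boolean connectives are defined as usual and $\Diamond A:=\neg\Box\neg A$. $\mathbf{IL}$ is the smallest set of formulas containing all propositional tautologies and all instances of the schemata below and closed under Modus Ponens and Necessitation (from $A$ infer $\Box A$); $\mathbf{IL}\vdash A$ means $A\in\mathbf{IL}$: L1: $\Box(A\rightarrow B)\rightarrow(\Box A\rightarrow\Box B)$; L2: $\Box A\rightarrow\Box\Box A$; L3: $\Box(\Box A\rightarrow A)\rightarrow\Box A$; J1: $\Box(A\rightarrow B)\rightarrow (A\rhd B)$; J2: $(A\rhd B)\wedge(B\rhd C)\rightarrow (A\rhd C)$; J3: $(A\rhd C)\wedge(B\rhd C)\rightarrow ((A\vee B)\rhd C)$; J4: $(A\rhd B)\rightarrow(\Diamond A\rightarrow\Diamond B)$; J5: $\Diamond A\rhd A$. An $\mathbf{IL}_{\mathrm{set}}$-frame is a structure $\langle W,R,S\rangle$ where $W$ is a non-empty set, $R$ is a transitive and conversely well-founded binary relation on $W$ (every non-empty subset of $W$ has an $R$-maximal element), and $S\subseteq W\times W\times(\mathcal P(W)\setminus\{\emptyset\})$ satisfies, writing $yS_xY$ for $(x,y,Y)\in S$: (a) if $xS_wY$ then $wRx$ and $wRy$ for all $y\in Y$; (b) $wRx$ implies $xS_w\{x\}$; (c) if $xS_wY$, then for all $y\in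 Y$ and all $Z$: if $y\notin Z$ and $yS_wZ$ then $xS_wZ$; (d) $wRx$ and $xRy$ imply $xS_w\{y\}$. An $\mathbf{IL}_{\mathrm{set}}$-model based on such a frame is obtained by adding a relation $\Vdash$ between worlds and formulas that commutes with boolean connectives and satisfies: $w\Vdash\Box A$ iff $x\Vdash A$ for all $x$ with $wRx$; $w\Vdash A\rhd B$ iff for all $x$ with $wRx$ and $x\Vdash A$ there is $Y$ with $xS_wY$ and $y\Vdash B$ for all $y\in Y$. $A$ is valid on $F$ if $w\Vdash A$ for every world $w$ of every model based on $F$. *)

theory Defs
  imports Main
begin

datatype fm =
    Falsum  (\<open>\<^bold>\<bottom>\<close>)
  | Var nat
  | Imp fm fm  (infixr \<open>\<^bold>\<rightarrow>\<close> 55)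
  | Box fm  (\<open>\<^bold>\<box> _\<close> [80] 80)
  | Rhd fm fm  (infix \<open>\<^bold>\<rhd>\<close> 60)

abbreviation Neg :: "fm \<Rightarrow> fm"  (\<open>\<^bold>\<not> _\<close> [80] 80)
  where "\<^bold>\<not> A \<equiv> A \<^bold>\<rightarrow> \<^bold>\<bottom>"

abbreviation Disj :: "fm \<Rightarrow> fm \<Rightarrow> fm"  (infixr \<open>\<^bold>\<or>\<close> 65)
  where "A \<^bold>\<or> B \<equiv> \<^bold>\<not> A \<^bold>\<rightarrow> B"

abbreviation Conj :: "fm \<Rightarrow> fm \<Rightarrow> fm"  (infixr \<open>\<^bold>\<and>\<close> 70)
  where "A \<^bold>\<and> B \<equiv> \<^bold>\<not> (A \<^bold>\<rightarrow> \<^bold>\<not> B)"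

abbreviation Dia :: "fm \<Rightarrow> fm"  (\<open>\<^bold>\<diamond> _\<close> [80] 80)
  where "\<^bold>\<diamond> A \<equiv> \<^bold>\<not> (\<^bold>\<box> (\<^bold>\<not> A))"

text \<open>Modal subformulas are treated as propositional atoms, so that tautologies include
  all substitution instances of classical tautologies by modal formulas.\<close>

fun pval :: "(fm \<Rightarrow> bool) \<Rightarrow> fm \<Rightarrow> bool" where
  "pval v \<^bold>\<bottom> = False"
| "pval v (A \<^bold>\<rightarrow> B) = (pval v A \<longrightarrow> pval v B)"
| "pval v A = v A"

definition tautology :: "fm \<Rightarrow> bool"
  where "tautology A \<longleftrightarrow> (\<forall>v. pval v A)"

inductive_set IL :: "fm set" where
  Taut: "tautology A \<Longrightarrow> A \<in> IL"
| L1: "\<^bold>\<box> (A \<^bold>\<rightarrow> B) \<^bold>\<rightarrow> (\<^bold>\<box> A \<^bold>\<rightarrow> \<^bold>\<box> B) \<in> IL"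
| L2: "\<^bold>\<box> A \<^bold>\<rightarrow> \<^bold>\<box> (\<^bold>\<box> A) \<in> IL"
| L3: "\<^bold>\<box> (\<^bold>\<box> A \<^bold>\<rightarrow> A) \<^bold>\<rightarrow> \<^bold>\<box> A \<in> IL"
| J1: "\<^bold>\<box> (A \<^bold>\<rightarrow> B) \<^bold>\<rightarrow> (A \<^bold>\<rhd> B) \<in> IL"
| J2: "(A \<^bold>\<rhd> B) \<^bold>\<and> (B \<^bold>\<rhd> C) \<^bold>\<rightarrow> (A \<^bold>\<rhd> C) \<in> IL"
| J3: "(A \<^bold>\<rhd> C) \<^bold>\<and> (B \<^bold>\<rhd> C) \<^bold>\<rightarrow> ((A \<^bold>\<or> B) \<^bold>\<rhd> C) \<in> IL"
| J4: "(A \<^bold>\<rhd> B) \<^bold>\<rightarrow> (\<^bold>\<diamond> A \<^bold>\<rightarrow> \<^bold>\<diamond> B) \<in> IL"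
| J5: "(\<^bold>\<diamond> A) \<^bold>\<rhd> A \<in> IL"
| MP: "A \<^bold>\<rightarrow> B \<in> IL \<Longrightarrow> A \<in> IL \<Longrightarrow> B \<in> IL"
| Nec: "A \<in> IL \<Longrightarrow> \<^bold>\<box> A \<in> IL"

abbreviation IL_proves :: "fm \<Rightarrow> bool"  (\<open>IL\<turnstile> _\<close> [50] 50)
  where "IL\<turnstile> A \<equiv> A \<in> IL"

text \<open>A triple \<open>(w, x, Y) \<in> S\<close> is \<open>x S\<^sub>w Y\<close>: the index world comes first.\<close>

locale ILset_frame =
  fixes W :: "'w set"
    and R :: "('w \<times> 'w) set"
    and S :: "('w \<times> 'w \<times> 'w set) set"
  assumes W_nonempty: "W \<noteq> {}"
    and R_sub: "R \<subseteq> W \<times> W"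
    and R_trans: "trans R"
    and R_conv_wf: "\<And>X. X \<subseteq> W \<Longrightarrow> X \<noteq> {} \<Longrightarrow> \<exists>m\<in>X. \<forall>y\<in>X. (m, y) \<notin> R"
    and S_sub: "S \<subseteq> W \<times> W \<times> (Pow W - {{}})"
    and S_R: "\<And>w x Y. (w, x, Y) \<in> S \<Longrightarrow> (w, x) \<in> R \<and> (\<forall>y\<in>Y. (w, y) \<in> R)"
    and S_quasi_refl: "\<And>w x. (w, x) \<in> R \<Longrightarrow> (w, x, {x}) \<in> S"
    and S_quasi_trans:
      "\<And>w x Y y Z. (w, x, Y) \<in> S \<Longrightarrow> y \<in> Y \<Longrightarrow> y \<notin> Z \<Longrightarrow> (w, y, Z) \<in> S \<Longrightarrow> (w, x, Z) \<in> S"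
    and R_S: "\<And>w x y. (w, x) \<in> R \<Longrightarrow> (x, y) \<in> R \<Longrightarrow> (w, x, {y}) \<in> S"

text \<open>Worlds form a subset of an ambient type \<open>'w\<close>. HOL cannot quantify over types inside a
  hypothesis, so validity on every frame is expressed relative to one arbitrary infinite \<open>'w\<close>;
  \<open>W\<close> itself may be finite. The values of the forcing relation outside \<open>W\<close> are irrelevant.\<close>

locale ILset_model = ILset_frame W R S
  for W :: "'w set"
    and R :: "('w \<times> 'w) set"
    and S :: "('w \<times> 'w \<times> 'w set) set" +
  fixes forces :: "'w \<Rightarrow> fm \<Rightarrow> bool"
  assumes forces_Falsum: "\<And>w. w \<in> W \<Longrightarrow> \<not> forces w \<^bold>\<bottom>"
    and forces_Imp: "\<And>w A B. w \<in> W \<Longrightarrow> forces w (A \<^bold>\<rightarrow> B) \<longleftrightarrow> (forces w A \<longrightarrow> forces w B)"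
    and forces_Box: "\<And>w A. w \<in> W \<Longrightarrow> forces w (\<^bold>\<box> A) \<longleftrightarrow> (\<forall>x. (w, x) \<in> R \<longrightarrow> forces x A)"
    and forces_Rhd: "\<And>w A B. w \<in> W \<Longrightarrow> forces w (A \<^bold>\<rhd> B) \<longleftrightarrow>
      (\<forall>x. (w, x) \<in> R \<longrightarrow> forces x A \<longrightarrow> (\<exists>Y. (w, x, Y) \<in> S \<and> (\<forall>y\<in>Y. forces y B)))"

definition valid_on ::
  "'w set \<Rightarrow> ('w \<times> 'w) set \<Rightarrow> ('w \<times> 'w \<times> 'w set) set \<Rightarrow> fm \<Rightarrow> bool"
  where "valid_on W R S A \<longleftrightarrow>
    (\<forall>forces. ILset_model W R S forces \<longrightarrow> (\<forall>w\<in>W. forces w A))"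

end

theory Submission
  imports Defs "HOL-Library.Countable"
begin

text \<open>
  If \<open>A\<close> is unprovable, some maximal consistent set \<open>G\<close> omits \<open>A\<close>. The countermodel is a tree of
  finite lists of pairs \<open>(B, C)\<close>, each labelled by a maximal consistent set: \<open>[]\<close> is labelled
  by \<open>G\<close>, and \<open>ws @ [(B, C)]\<close> is a world if \<open>B \<rhd> C\<close> fails at the label of \<open>ws\<close>; its label is then
  a \<open>C\<close>-critical successor containing \<open>B\<close> and \<open>\<box>\<not>B\<close> (de Jongh and Veltman). \<open>R\<close> is
  proper prefix, and \<open>x S\<^sub>w {y}\<close> means that the branches to \<open>x\<close> and to \<open>y\<close> leave \<open>w\<close> with the same
  second component \<open>C\<close>; only singletons occur on the right. A formula \<open>B\<close> cannot be used twice on a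
  branch, because \<open>\<box>\<not>B\<close> persists, so restricting \<open>B\<close> to a finite set gives converse
  well-foundedness. The tree is countable, hence embeds into any infinite type.
\<close>

section \<open>Theories and maximal consistent sets\<close>

text \<open>Necessitation is left to \<open>IL\<close> alone, because the label of a world need not
  be closed under it.\<close>

definition closed_theory :: "fm set \<Rightarrow> bool"
  where "closed_theory T \<longleftrightarrow> IL \<subseteq> T \<and> (\<forall>A B. A \<^bold>\<rightarrow> B \<in> T \<longrightarrow> A \<in> T \<longrightarrow> B \<in> T)"

definition mcs :: "fm set \<Rightarrow> bool"
  where "mcs M \<longleftrightarrow> closed_theory M \<and> \<^bold>\<bottom> \<notin> M \<and> (\<forall>A. A \<in> M \<or> \<^bold>\<not> A \<in> M)"

lemma closed_theoryI:
  assumes "\<And>A. A \<in> IL \<Longrightarrow> A \<in> T" "\<And>A B. A \<^bold>\<rightarrow> B \<in> T \<Longrightarrow> A \<in> T \<Longrightarrow> B \<in> T"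
  shows "closed_theory T"
  using assms unfolding closed_theory_def by blast

lemma closed_theory_IL: "closed_theory IL"
  by (rule closed_theoryI) (auto intro: IL.MP)

lemma theory_IL: "closed_theory T \<Longrightarrow> A \<in> IL \<Longrightarrow> A \<in> T"
  unfolding closed_theory_def by blast

lemma theory_MP: "closed_theory T \<Longrightarrow> A \<^bold>\<rightarrow> B \<in> T \<Longrightarrow> A \<in> T \<Longrightarrow> B \<in> T"
  unfolding closed_theory_def by blast

lemma theory_taut: "closed_theory T \<Longrightarrow> tautology A \<Longrightarrow> A \<in> T"
  by (simp add: theory_IL IL.Taut)

lemma theory_taut1: "closed_theory T \<Longrightarrow> tautology (A \<^bold>\<rightarrow> B) \<Longrightarrow> A \<in> T \<Longrightarrow> B \<in> T"
  by (meson theory_taut theory_MP)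

lemma theory_taut2:
  "closed_theory T \<Longrightarrow> tautology (A \<^bold>\<rightarrow> B \<^bold>\<rightarrow> C) \<Longrightarrow> A \<in> T \<Longrightarrow> B \<in> T \<Longrightarrow> C \<in> T"
  by (meson theory_taut theory_MP)

lemma theory_conjI: "closed_theory T \<Longrightarrow> A \<in> T \<Longrightarrow> B \<in> T \<Longrightarrow> A \<^bold>\<and> B \<in> T"
  by (rule theory_taut2[where A = A and B = B]) (auto simp: tautology_def)

text \<open>The deduction theorem in set form: with modus ponens as the only rule, this is the
  theory generated by \<open>T\<close> and \<open>A\<close>.\<close>

lemma closed_theory_hypothesis:
  assumes "closed_theory T"
  shows "closed_theory {B. A \<^bold>\<rightarrow> B \<in> T}"
proof (rule closed_theoryI)
  fix B assume "B \<in> IL"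
  then have "B \<in> T" using assms by (rule theory_IL[rotated])
  then have "A \<^bold>\<rightarrow> B \<in> T"
    by (rule theory_taut1[OF assms, rotated]) (auto simp: tautology_def)
  then show "B \<in> {B. A \<^bold>\<rightarrow> B \<in> T}" by simp
next
  fix B C assume "B \<^bold>\<rightarrow> C \<in> {B. A \<^bold>\<rightarrow> B \<in> T}" "B \<in> {B. A \<^bold>\<rightarrow> B \<in> T}"
  then have "A \<^bold>\<rightarrow> B \<^bold>\<rightarrow> C \<in> T" "A \<^bold>\<rightarrow> B \<in> T" by auto
  then have "A \<^bold>\<rightarrow> C \<in> T"
    by (rule theory_taut2[OF assms, rotated]) (auto simp: tautology_def)
  then show "C \<in> {B. A \<^bold>\<rightarrow> B \<in> T}" by simp
qed

text \<open>Zorn's lemma is applied to the theories omitting \<open>A\<close>, since omission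
  survives unions of chains. A maximal one lacking both \<open>B\<close> and \<open>\<not> B\<close>
  would contain \<open>B \<rightarrow> A\<close> and \<open>\<not> B \<rightarrow> A\<close>, hence
  \<open>A\<close>.\<close>

lemma lindenbaum:
  assumes T: "closed_theory T" and A: "A \<notin> T"
  obtains M where "mcs M" "T \<subseteq> M" "A \<notin> M"
proof -
  let ?P = "{M. closed_theory M \<and> T \<subseteq> M \<and> A \<notin> M}"
  have "\<exists>M\<in>?P. \<forall>X\<in>?P. M \<subseteq> X \<longrightarrow> X = M"
  proof (rule subset_Zorn_nonempty)
    show "?P \<noteq> {}" using T A by blast
  next
    fix \<C> assume ne: "\<C> \<noteq> {}" and ch: "subset.chain ?P \<C>"
    have P: "closed_theory M" "T \<subseteq> M" "A \<notin> M" if "M \<in> \<C>" for M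
      using ch that unfolding subset.chain_def by auto
    have "closed_theory (\<Union>\<C>)"
    proof (rule closed_theoryI)
      fix B assume "B \<in> IL"
      then show "B \<in> \<Union>\<C>" using ne P(1) theory_IL by blast
    next
      fix B C assume "B \<^bold>\<rightarrow> C \<in> \<Union>\<C>" "B \<in> \<Union>\<C>"
      then obtain X Y where XY: "X \<in> \<C>" "Y \<in> \<C>" "B \<^bold>\<rightarrow> C \<in> X" "B \<in> Y" by blast
      then have "X \<subseteq> Y \<or> Y \<subseteq> X" using ch by (auto simp: subset_chain_def)
      then show "C \<in> \<Union>\<C>" using XY P(1) theory_MP by blast
    qed
    moreover have "T \<subseteq> \<Union>\<C>" using ne P(2) by blast
    moreover have "A \<notin> \<Union>\<C>" using P(3) by blast
    ultimately show "\<Union>\<C> \<in> ?P" by blast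
  qed
  then obtain M where M: "closed_theory M" "T \<subseteq> M" "A \<notin> M"
    and max: "\<And>X. closed_theory X \<Longrightarrow> T \<subseteq> X \<Longrightarrow> A \<notin> X \<Longrightarrow> M \<subseteq> X \<Longrightarrow> X = M"
    by auto
  \<comment> \<open>Adjoining \<open>B\<close> to \<open>M\<close> gives a strictly larger theory,
    which by maximality cannot omit \<open>A\<close>.\<close>
  have imp: "B \<^bold>\<rightarrow> A \<in> M" if "B \<notin> M" for B
  proof (rule ccontr)
    let ?X = "{D. B \<^bold>\<rightarrow> D \<in> M}"
    assume "B \<^bold>\<rightarrow> A \<notin> M"
    moreover have sub: "M \<subseteq> ?X"
    proof
      fix D assume "D \<in> M"
      then have "B \<^bold>\<rightarrow> D \<in> M"
        by (rule theory_taut1[OF M(1), rotated]) (auto simp: tautology_def)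
      then show "D \<in> ?X" by simp
    qed
    ultimately have "?X = M"
      using closed_theory_hypothesis[OF M(1), of B] M(2) by (intro max) auto
    moreover have "B \<in> ?X" using M(1) by (auto simp: tautology_def intro: theory_taut)
    ultimately show False using that by blast
  qed
  have "B \<in> M \<or> \<^bold>\<not> B \<in> M" for B
  proof (rule ccontr)
    assume "\<not> ?thesis"
    then have "B \<^bold>\<rightarrow> A \<in> M" "\<^bold>\<not> B \<^bold>\<rightarrow> A \<in> M" using imp by auto
    then have "A \<in> M"
      by (rule theory_taut2[OF M(1), rotated]) (auto simp: tautology_def)
    then show False using M(3) by blast
  qed
  moreover have "\<^bold>\<bottom> \<notin> M"
    using theory_taut1[OF M(1), of "\<^bold>\<bottom>" A] M(3) by (auto simp: tautology_def)
  ultimately show thesis using M that unfolding mcs_def by blast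
qed

lemma mcs_closed_theory: "mcs M \<Longrightarrow> closed_theory M"
  unfolding mcs_def by blast

lemma mcs_Falsum: "mcs M \<Longrightarrow> \<^bold>\<bottom> \<notin> M"
  unfolding mcs_def by blast

lemma mcs_Neg: "mcs M \<Longrightarrow> \<^bold>\<not> A \<in> M \<longleftrightarrow> A \<notin> M"
  unfolding mcs_def using theory_MP by blast

lemma mcs_Imp:
  assumes "mcs M"
  shows "A \<^bold>\<rightarrow> B \<in> M \<longleftrightarrow> (A \<in> M \<longrightarrow> B \<in> M)"
proof -
  note T = mcs_closed_theory[OF assms]
  have "A \<^bold>\<rightarrow> B \<in> M" if "B \<in> M"
    using theory_taut1[OF T _ that, of "A \<^bold>\<rightarrow> B"] by (auto simp: tautology_def)
  moreover have "A \<^bold>\<rightarrow> B \<in> M" if "\<^bold>\<not> A \<in> M"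
    using theory_taut1[OF T _ that, of "A \<^bold>\<rightarrow> B"] by (auto simp: tautology_def)
  ultimately show ?thesis using theory_MP[OF T] mcs_Neg[OF assms] by blast
qed

section \<open>Derived rules of IL\<close>

context
  fixes T assumes T: "closed_theory T"
begin

lemma theory_box_MP: "\<^bold>\<box> (A \<^bold>\<rightarrow> B) \<in> T \<Longrightarrow> \<^bold>\<box> A \<in> T \<Longrightarrow> \<^bold>\<box> B \<in> T"
  using theory_MP[OF T] theory_IL[OF T IL.L1] by blast

lemma theory_box_mono: "A \<^bold>\<rightarrow> B \<in> IL \<Longrightarrow> \<^bold>\<box> A \<in> T \<Longrightarrow> \<^bold>\<box> B \<in> T"
  using theory_box_MP theory_IL[OF T IL.Nec] by blast

lemma theory_rhd_box: "\<^bold>\<box> (A \<^bold>\<rightarrow> B) \<in> T \<Longrightarrow> A \<^bold>\<rhd> B \<in> T"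
  using theory_MP[OF T] theory_IL[OF T IL.J1] by blast

lemma theory_rhd_IL: "A \<^bold>\<rightarrow> B \<in> IL \<Longrightarrow> A \<^bold>\<rhd> B \<in> T"
  using theory_rhd_box theory_IL[OF T IL.Nec] by blast

lemma theory_rhd_taut: "tautology (A \<^bold>\<rightarrow> B) \<Longrightarrow> A \<^bold>\<rhd> B \<in> T"
  by (simp add: theory_rhd_IL IL.Taut)

lemma theory_rhd_trans: "A \<^bold>\<rhd> B \<in> T \<Longrightarrow> B \<^bold>\<rhd> C \<in> T \<Longrightarrow> A \<^bold>\<rhd> C \<in> T"
  using theory_MP[OF T theory_IL[OF T IL.J2]] theory_conjI[OF T] by blast

lemma theory_rhd_disj: "A \<^bold>\<rhd> C \<in> T \<Longrightarrow> B \<^bold>\<rhd> C \<in> T \<Longrightarrow> (A \<^bold>\<or> B) \<^bold>\<rhd> C \<in> T"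
  using theory_MP[OF T theory_IL[OF T IL.J3]] theory_conjI[OF T] by blast

lemma theory_rhd_dia: "(\<^bold>\<diamond> A) \<^bold>\<rhd> A \<in> T"
  by (rule theory_IL[OF T IL.J5])

lemma theory_rhd_strengthen: "tautology (A \<^bold>\<rightarrow> B) \<Longrightarrow> B \<^bold>\<rhd> C \<in> T \<Longrightarrow> A \<^bold>\<rhd> C \<in> T"
  using theory_rhd_taut theory_rhd_trans by blast

text \<open>By L3 for \<open>\<not> B\<close>, \<open>B\<close> implies
  \<open>?B \<or> \<diamond> ?B\<close>, and J5 with J3 absorbs the diamond. This is what lets a
  successor for \<open>B\<close> contain \<open>\<box> \<not> B\<close> too.\<close>

lemma theory_rhd_lob: "B \<^bold>\<rhd> (B \<^bold>\<and> \<^bold>\<box> (\<^bold>\<not> B)) \<in> T"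
proof -
  let ?B = "B \<^bold>\<and> \<^bold>\<box> (\<^bold>\<not> B)"
  have "\<^bold>\<box> (\<^bold>\<not> ?B \<^bold>\<rightarrow> (\<^bold>\<box> (\<^bold>\<not> B) \<^bold>\<rightarrow> \<^bold>\<not> B)) \<in> IL"
    by (intro IL.Nec IL.Taut) (auto simp: tautology_def)
  then have "\<^bold>\<box> (\<^bold>\<not> ?B) \<^bold>\<rightarrow> \<^bold>\<box> (\<^bold>\<box> (\<^bold>\<not> B) \<^bold>\<rightarrow> \<^bold>\<not> B) \<in> IL"
    by (rule IL.MP[OF IL.L1])
  \<comment> \<open>If \<open>B\<close> holds and \<open>?B\<close> fails, then
    \<open>\<box> \<not> B\<close> fails; L3 and the implication just derived refute
    \<open>\<box> \<not> ?B\<close>.\<close>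
  then have "B \<^bold>\<rightarrow> (?B \<^bold>\<or> \<^bold>\<diamond> ?B) \<in> IL"
    by (rule theory_taut2[OF closed_theory_IL, rotated, OF _ IL.L3])
      (auto simp: tautology_def)
  then have "B \<^bold>\<rhd> (?B \<^bold>\<or> \<^bold>\<diamond> ?B) \<in> T" by (rule theory_rhd_IL)
  moreover have "?B \<^bold>\<rhd> ?B \<in> T" by (rule theory_rhd_taut) (simp add: tautology_def)
  ultimately show ?thesis using theory_rhd_disj theory_rhd_dia theory_rhd_trans by blast
qed

text \<open>J4 reduces this to the refutability of \<open>\<diamond> \<bottom>\<close>. A failing
  \<open>\<box> A\<close> can thus be treated as a failing \<open>\<not> A \<rhd> \<bottom>\<close>,
  so one kind of successor serves both modalities.\<close>

lemma theory_rhd_Falsum: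
  assumes "\<^bold>\<not> A \<^bold>\<rhd> \<^bold>\<bottom> \<in> T"
  shows "\<^bold>\<box> A \<in> T"
proof -
  have "\<^bold>\<diamond> (\<^bold>\<not> A) \<^bold>\<rightarrow> \<^bold>\<diamond> \<^bold>\<bottom> \<in> T"
    using theory_MP[OF T theory_IL[OF T IL.J4] assms] .
  moreover have "\<^bold>\<box> (\<^bold>\<not> \<^bold>\<bottom>) \<in> T"
    by (intro theory_IL[OF T] IL.Nec IL.Taut) (simp add: tautology_def)
  ultimately have "\<^bold>\<box> (\<^bold>\<not> \<^bold>\<not> A) \<in> T"
    by (rule theory_taut2[OF T, rotated]) (auto simp: tautology_def)
  then show ?thesis
    by (rule theory_box_mono[rotated]) (auto simp: tautology_def intro: IL.Taut)
qed

end

section \<open>Critical successors\<close>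

text \<open>Maximality of \<open>D\<close> is not demanded: the clauses are first verified for a
  theory and survive its enlargement.\<close>

definition critical :: "fm set \<Rightarrow> fm \<Rightarrow> fm set \<Rightarrow> bool"
  where "critical G C D \<longleftrightarrow>
    (\<forall>A. \<^bold>\<box> A \<in> G \<longrightarrow> A \<in> D \<and> \<^bold>\<box> A \<in> D) \<and>
    (\<forall>A. A \<^bold>\<rhd> C \<in> G \<longrightarrow> \<^bold>\<not> A \<in> D \<and> \<^bold>\<box> (\<^bold>\<not> A) \<in> D)"

text \<open>Whatever criticality puts into \<open>D\<close> it also puts there boxed, and boxed
  formulas persist to \<open>E\<close>.\<close>

lemma critical_trans: "critical G C D \<Longrightarrow> critical D C' E \<Longrightarrow> critical G C E"
  unfolding critical_def by blast

text \<open>Inconsistency of the theory \<open>D\<close> built below would put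
  \<open>?B \<rhd> C\<close> into \<open>G\<close>, and \<open>theory_rhd_lob\<close> would turn
  this into \<open>B \<rhd> C\<close>. A maximal consistent extension of \<open>D\<close> is then
  the required set.\<close>

lemma critical_exists:
  assumes G: "mcs G" and BC: "B \<^bold>\<rhd> C \<notin> G"
  shows "\<exists>D. mcs D \<and> critical G C D \<and> B \<in> D \<and> \<^bold>\<box> (\<^bold>\<not> B) \<in> D"
proof -
  note T = mcs_closed_theory[OF G]
  let ?B = "B \<^bold>\<and> \<^bold>\<box> (\<^bold>\<not> B)"
  \<comment> \<open>J3 makes \<open>D\<close> closed under modus ponens, so consistency of the successor needs no argument
    with finite disjunctions.\<close>
  define D where "D = {A. (?B \<^bold>\<and> \<^bold>\<not> A) \<^bold>\<rhd> C \<in> G}"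
  have taut: "A \<in> D" if "tautology (?B \<^bold>\<rightarrow> A)" for A
  proof -
    have "\<^bold>\<bottom> \<^bold>\<rhd> C \<in> G" by (rule theory_rhd_taut[OF T]) (simp add: tautology_def)
    then have "(?B \<^bold>\<and> \<^bold>\<not> A) \<^bold>\<rhd> C \<in> G"
      by (rule theory_rhd_strengthen[OF T, rotated]) (use that in \<open>auto simp: tautology_def\<close>)
    then show ?thesis by (simp add: D_def)
  qed
  have box: "A \<in> D" if "\<^bold>\<box> A \<in> G" for A
  proof -
    have "\<^bold>\<box> ((?B \<^bold>\<and> \<^bold>\<not> A) \<^bold>\<rightarrow> C) \<in> G"
      by (rule theory_box_mono[OF T _ that]) (auto simp: tautology_def intro: IL.Taut)
    then show ?thesis by (auto simp: D_def intro: theory_rhd_box[OF T])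
  qed
  have neg: "\<^bold>\<not> A \<in> D" if "A \<^bold>\<rhd> C \<in> G" for A
    using theory_rhd_strengthen[OF T _ that, of "?B \<^bold>\<and> \<^bold>\<not> (\<^bold>\<not> A)"]
    by (auto simp: D_def tautology_def)
  have "closed_theory D"
  proof (rule closed_theoryI)
    fix A assume "A \<in> IL"
    then show "A \<in> D" by (intro box theory_IL[OF T] IL.Nec)
  next
    fix A A' assume "A \<^bold>\<rightarrow> A' \<in> D" "A \<in> D"
    then have "((?B \<^bold>\<and> \<^bold>\<not> (A \<^bold>\<rightarrow> A')) \<^bold>\<or> (?B \<^bold>\<and> \<^bold>\<not> A)) \<^bold>\<rhd> C \<in> G"
      unfolding D_def by (auto intro: theory_rhd_disj[OF T])
    then have "(?B \<^bold>\<and> \<^bold>\<not> A') \<^bold>\<rhd> C \<in> G"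
      by (rule theory_rhd_strengthen[OF T, rotated]) (auto simp: tautology_def)
    then show "A' \<in> D" by (simp add: D_def)
  qed
  moreover have "\<^bold>\<bottom> \<notin> D"
  proof
    assume "\<^bold>\<bottom> \<in> D"
    then have "?B \<^bold>\<rhd> C \<in> G"
      using theory_rhd_strengthen[OF T, of ?B "?B \<^bold>\<and> \<^bold>\<not> \<^bold>\<bottom>" C]
      by (auto simp: D_def tautology_def)
    then show False using BC theory_rhd_trans[OF T theory_rhd_lob[OF T]] by blast
  qed
  ultimately obtain M where M: "mcs M" "D \<subseteq> M" by (rule lindenbaum)
  have "critical G C D"
    unfolding critical_def
  proof (intro conjI allI impI)
    fix A assume A: "\<^bold>\<box> A \<in> G"
    then show "A \<in> D" by (rule box)
    show "\<^bold>\<box> A \<in> D" using A by (intro box theory_MP[OF T theory_IL[OF T IL.L2]])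
  next
    fix A assume A: "A \<^bold>\<rhd> C \<in> G"
    then show "\<^bold>\<not> A \<in> D" by (rule neg)
    \<comment> \<open>J5 and J2 turn \<open>A \<rhd> C\<close> into
      \<open>\<diamond> A \<rhd> C\<close>, so \<open>neg\<close> applies to
      \<open>\<diamond> A\<close> as well.\<close>
    have "\<^bold>\<not> (\<^bold>\<diamond> A) \<in> D"
      using neg[OF theory_rhd_trans[OF T theory_rhd_dia[OF T] A]] .
    then show "\<^bold>\<box> (\<^bold>\<not> A) \<in> D"
      by (rule theory_taut1[OF \<open>closed_theory D\<close>, rotated]) (auto simp: tautology_def)
  qed
  then have "critical G C M" using M(2) unfolding critical_def by blast
  moreover have "B \<in> D" "\<^bold>\<box> (\<^bold>\<not> B) \<in> D" by (auto intro: taut simp: tautology_def)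
  ultimately show ?thesis using M by blast
qed

text \<open>Otherwise J2 would give \<open>A \<rhd> C\<close>, and criticality would put
  \<open>\<not> A\<close> into \<open>D\<close>. Hence \<open>G\<close> has a
  \<open>C\<close>-critical successor containing \<open>B\<close>, with the same index
  \<open>C\<close>.\<close>

lemma critical_rhd_transfer:
  assumes "mcs G" "mcs D" "critical G C D" "A \<^bold>\<rhd> B \<in> G" "A \<in> D"
  shows "B \<^bold>\<rhd> C \<notin> G"
  using assms theory_rhd_trans[OF mcs_closed_theory[OF assms(1)]] mcs_Neg[OF assms(2)]
  unfolding critical_def by blast

section \<open>The tree of critical successors\<close>

text \<open>A fixed choice makes the label a function of the branch, so a world can be a bare
  list.\<close>

definition crit_succ :: "fm set \<Rightarrow> fm \<times> fm \<Rightarrow> fm set"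
  where "crit_succ G p = (SOME D. mcs D \<and> critical G (snd p) D \<and> fst p \<in> D \<and> \<^bold>\<box> (\<^bold>\<not> fst p) \<in> D)"

definition label :: "fm set \<Rightarrow> (fm \<times> fm) list \<Rightarrow> fm set"
  where "label G ws = foldl crit_succ G ws"

lemma label_simps [simp]:
  "label G [] = G" "label G (ws @ [p]) = crit_succ (label G ws) p"
  by (simp_all add: label_def)

lemma crit_succ:
  assumes "mcs G" "B \<^bold>\<rhd> C \<notin> G"
  shows "mcs (crit_succ G (B, C))" "critical G C (crit_succ G (B, C))"
    "B \<in> crit_succ G (B, C)" "\<^bold>\<box> (\<^bold>\<not> B) \<in> crit_succ G (B, C)"
  using someI_ex[OF critical_exists[OF assms]] by (simp_all add: crit_succ_def)

text \<open>Only first components are confined to \<open>F\<close>; second components range over all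
  formulas, so the tree may branch infinitely even when its depth is bounded.\<close>

inductive_set worlds :: "fm set \<Rightarrow> fm set \<Rightarrow> (fm \<times> fm) list set" for F G where
  root: "[] \<in> worlds F G"
| step: "ws \<in> worlds F G \<Longrightarrow> B \<in> F \<Longrightarrow> B \<^bold>\<rhd> C \<notin> label G ws \<Longrightarrow> ws @ [(B, C)] \<in> worlds F G"

inductive_cases worlds_snocE: "ws @ [p] \<in> worlds F G"

definition tree_R :: "fm set \<Rightarrow> fm set \<Rightarrow> ((fm \<times> fm) list \<times> (fm \<times> fm) list) set"
  where "tree_R F G = {(w, w @ p # s) | w p s. w @ p # s \<in> worlds F G}"

definition tree_S ::
  "fm set \<Rightarrow> fm set \<Rightarrow> ((fm \<times> fm) list \<times> (fm \<times> fm) list \<times> (fm \<times> fm) list set) set"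
  where "tree_S F G = {(w, w @ (A, C) # s, {w @ (B, C) # t}) | w A B C s t.
    w @ (A, C) # s \<in> worlds F G \<and> w @ (B, C) # t \<in> worlds F G}"

lemma worlds_prefix: "ws @ vs \<in> worlds F G \<Longrightarrow> ws \<in> worlds F G"
proof (induction vs rule: rev_induct)
  case (snoc p vs)
  then have "(ws @ vs) @ [p] \<in> worlds F G" by simp
  then have "ws @ vs \<in> worlds F G" by (rule worlds_snocE) auto
  then show ?case by (rule snoc.IH)
qed simp

context
  fixes F G :: "fm set"
  assumes G: "mcs G"
begin

lemma mcs_label: "ws \<in> worlds F G \<Longrightarrow> mcs (label G ws)"
  by (induction rule: worlds.induct) (auto simp: G crit_succ)

text \<open>The first pair after \<open>w\<close> fixes the index for the whole subtree above it, by
  \<open>critical_trans\<close>. This is why \<open>tree_S\<close> compares only that pair.\<close>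

lemma critical_label:
  "w @ (B, C) # s \<in> worlds F G \<Longrightarrow> critical (label G w) C (label G (w @ (B, C) # s))"
proof (induction s rule: rev_induct)
  case Nil
  then show ?case
    by (auto elim!: worlds_snocE simp: crit_succ mcs_label)
next
  case (snoc p s)
  have "(w @ (B, C) # s) @ [p] \<in> worlds F G" using snoc.prems by simp
  then obtain B' C' where *: "w @ (B, C) # s \<in> worlds F G"
    "p = (B', C')" "B' \<^bold>\<rhd> C' \<notin> label G (w @ (B, C) # s)"
    by (rule worlds_snocE) auto
  have "critical (label G (w @ (B, C) # s)) C' (label G ((w @ (B, C) # s) @ [p]))"
    using * by (simp only: label_simps) (simp add: crit_succ mcs_label)
  then show ?case using critical_trans[OF snoc.IH[OF *(1)]] by simp
qed

text \<open>The last conjunct carries the induction: \<open>\<box> \<not> B\<close> yields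
  \<open>\<box> (B \<rightarrow> C)\<close> and so, by J1, \<open>B \<rhd> C\<close>, which blocks a
  second step with \<open>B\<close>.\<close>

lemma worlds_distinct:
  "ws \<in> worlds F G \<Longrightarrow> distinct (map fst ws) \<and> fst ` set ws \<subseteq> F \<and>
    (\<forall>B \<in> fst ` set ws. \<^bold>\<box> (\<^bold>\<not> B) \<in> label G ws)"
proof (induction rule: worlds.induct)
  case (step ws B C)
  note M = mcs_label[OF step(1)]
  note T = mcs_closed_theory[OF M]
  have "\<^bold>\<box> (\<^bold>\<not> B) \<notin> label G ws"
  proof
    assume "\<^bold>\<box> (\<^bold>\<not> B) \<in> label G ws"
    then have "\<^bold>\<box> (B \<^bold>\<rightarrow> C) \<in> label G ws"
      by (rule theory_box_mono[OF T, rotated]) (auto simp: tautology_def intro: IL.Taut)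
    then show False using theory_rhd_box[OF T] step by blast
  qed
  moreover have "\<^bold>\<box> A \<in> crit_succ (label G ws) (B, C)" if "\<^bold>\<box> A \<in> label G ws" for A
    using that crit_succ(2)[OF M step(3)] unfolding critical_def by blast
  ultimately show ?case using step crit_succ[OF M step(3)] by auto
qed simp

lemma worlds_length: "finite F \<Longrightarrow> ws \<in> worlds F G \<Longrightarrow> length ws \<le> card F"
  using worlds_distinct[of ws] distinct_card[of "map fst ws"] card_mono[of F "fst ` set ws"]
  by simp

text \<open>Having the same index above \<open>w\<close> is an equivalence on the proper extensions
  of \<open>w\<close>, and extending a branch keeps its index; this gives the conditions on
  \<open>tree_S\<close>.\<close>

lemma tree_frame:
  assumes F: "finite F"
  shows "ILset_frame (worlds F G) (tree_R F G) (tree_S F G)"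
proof
  show "worlds F G \<noteq> {}" using worlds.root by blast
  show "tree_R F G \<subseteq> worlds F G \<times> worlds F G"
    by (auto simp: tree_R_def dest: worlds_prefix)
  show "trans (tree_R F G)"
    by (rule transI) (force simp: tree_R_def)
  show "\<exists>m\<in>X. \<forall>y\<in>X. (m, y) \<notin> tree_R F G" if X: "X \<subseteq> worlds F G" "X \<noteq> {}" for X
  proof -
    \<comment> \<open>Bounded lengths give \<open>X\<close> a longest member, which is maximal
      because proper prefixes are shorter.\<close>
    have "\<forall>w. w \<in> X \<longrightarrow> length w < Suc (card F)"
      using X(1) worlds_length[OF F] by (auto simp: less_Suc_eq_le)
    then obtain m where "m \<in> X" "\<forall>y. y \<in> X \<longrightarrow> length y \<le> length m"
      using X(2) ex_has_greatest_nat[of "\<lambda>w. w \<in> X" _ length] by blast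
    moreover have "length x < length y" if "(x, y) \<in> tree_R F G" for x y
      using that by (auto simp: tree_R_def)
    ultimately show ?thesis by (meson not_less)
  qed
  show "tree_S F G \<subseteq> worlds F G \<times> worlds F G \<times> (Pow (worlds F G) - {{}})"
    by (auto simp: tree_S_def dest: worlds_prefix)
  show "(w, x) \<in> tree_R F G \<and> (\<forall>y\<in>Y. (w, y) \<in> tree_R F G)" if "(w, x, Y) \<in> tree_S F G" for w x Y
    using that by (auto simp: tree_S_def tree_R_def)
  show "(w, x, {x}) \<in> tree_S F G" if "(w, x) \<in> tree_R F G" for w x
    using that by (auto simp: tree_S_def tree_R_def)
  show "(w, x, Z) \<in> tree_S F G"
    if "(w, x, Y) \<in> tree_S F G" "y \<in> Y" "y \<notin> Z" "(w, y, Z) \<in> tree_S F G" for w x Y y Z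
    using that by (auto simp: tree_S_def)
  show "(w, x, {y}) \<in> tree_S F G" if "(w, x) \<in> tree_R F G" "(x, y) \<in> tree_R F G" for w x y
    using that by (auto simp: tree_S_def tree_R_def)
qed

end

section \<open>Truth lemma\<close>

text \<open>In a model forcing is a primitive relation subject to clauses; this recursion produces
  one from a valuation of the variables.\<close>

fun sat :: "('w \<times> 'w) set \<Rightarrow> ('w \<times> 'w \<times> 'w set) set \<Rightarrow> ('w \<Rightarrow> nat \<Rightarrow> bool) \<Rightarrow> 'w \<Rightarrow> fm \<Rightarrow> bool"
  where
    "sat R S V w \<^bold>\<bottom> \<longleftrightarrow> False"
  | "sat R S V w (Var n) \<longleftrightarrow> V w n"
  | "sat R S V w (A \<^bold>\<rightarrow> B) \<longleftrightarrow> (sat R S V w A \<longrightarrow> sat R S V w B)"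
  | "sat R S V w (\<^bold>\<box> A) \<longleftrightarrow> (\<forall>x. (w, x) \<in> R \<longrightarrow> sat R S V x A)"
  | "sat R S V w (A \<^bold>\<rhd> B) \<longleftrightarrow>
      (\<forall>x. (w, x) \<in> R \<longrightarrow> sat R S V x A \<longrightarrow> (\<exists>Y. (w, x, Y) \<in> S \<and> (\<forall>y\<in>Y. sat R S V y B)))"

lemma (in ILset_frame) ILset_model_sat: "ILset_model W R S (sat R S V)"
  by unfold_locales simp_all

text \<open>The first components of all pairs that the truth lemma appends: \<open>\<not> A\<close>
  refutes \<open>\<box> A\<close>, \<open>A\<close> refutes \<open>A \<rhd> B\<close>, and
  \<open>B\<close> supplies the witnesses for a true \<open>A \<rhd> B\<close>.\<close>

fun requests :: "fm \<Rightarrow> fm set" where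
  "requests (A \<^bold>\<rightarrow> B) = requests A \<union> requests B"
| "requests (\<^bold>\<box> A) = insert (\<^bold>\<not> A) (requests A)"
| "requests (A \<^bold>\<rhd> B) = {A, B} \<union> requests A \<union> requests B"
| "requests _ = {}"

lemma finite_requests: "finite (requests A)"
  by (induction A) auto

lemma truth_lemma:
  assumes G: "mcs G"
  shows "requests A \<subseteq> F \<Longrightarrow> w \<in> worlds F G \<Longrightarrow>
    sat (tree_R F G) (tree_S F G) (\<lambda>w n. Var n \<in> label G w) w A \<longleftrightarrow> A \<in> label G w"
proof (induction A arbitrary: w)
  case Falsum
  then show ?case using mcs_Falsum mcs_label[OF G] by simp
next
  case (Var n)
  then show ?case by simp
next
  case (Imp A B)
  then show ?case using mcs_Imp[OF mcs_label[OF G]] by simp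
next
  case (Box A)
  let ?sat = "sat (tree_R F G) (tree_S F G) (\<lambda>w n. Var n \<in> label G w)"
  note M = mcs_label[OF G Box.prems(2)]
  have IH: "?sat x A \<longleftrightarrow> A \<in> label G x" if "x \<in> worlds F G" for x
    using Box that by simp
  show ?case
  proof
    assume A: "\<^bold>\<box> A \<in> label G w"
    have "?sat x A" if "(w, x) \<in> tree_R F G" for x
    proof -
      obtain B C s where "x = w @ (B, C) # s" "x \<in> worlds F G"
        using \<open>(w, x) \<in> tree_R F G\<close> by (auto simp: tree_R_def)
      then show ?thesis using critical_label[OF G] A IH unfolding critical_def by blast
    qed
    then show "?sat w (\<^bold>\<box> A)" by simp
  next
    assume sat: "?sat w (\<^bold>\<box> A)"
    show "\<^bold>\<box> A \<in> label G w"
    proof (rule ccontr)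
      \<comment> \<open>The failing box is handled as a failing
        \<open>\<not> A \<rhd> \<bottom>\<close>, hence the index \<open>\<bottom>\<close>.\<close>
      let ?x = "w @ [(\<^bold>\<not> A, \<^bold>\<bottom>)]"
      assume "\<^bold>\<box> A \<notin> label G w"
      then have *: "\<^bold>\<not> A \<^bold>\<rhd> \<^bold>\<bottom> \<notin> label G w"
        using theory_rhd_Falsum[OF mcs_closed_theory[OF M]] by blast
      then have x: "?x \<in> worlds F G" using Box.prems by (auto intro: worlds.step)
      then have "(w, ?x) \<in> tree_R F G" by (auto simp: tree_R_def)
      then have "A \<in> label G ?x" using sat IH[OF x] by simp
      moreover have "\<^bold>\<not> A \<in> label G ?x" using crit_succ(3)[OF M *] by simp
      ultimately show False using mcs_Neg[OF mcs_label[OF G x]] by blast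
    qed
  qed
next
  case (Rhd A B)
  let ?sat = "sat (tree_R F G) (tree_S F G) (\<lambda>w n. Var n \<in> label G w)"
  note M = mcs_label[OF G Rhd.prems(2)]
  have IH: "?sat x A \<longleftrightarrow> A \<in> label G x" "?sat x B \<longleftrightarrow> B \<in> label G x" if "x \<in> worlds F G" for x
    using Rhd that by simp_all
  show ?case
  proof
    assume AB: "A \<^bold>\<rhd> B \<in> label G w"
    have "\<exists>Y. (w, x, Y) \<in> tree_S F G \<and> (\<forall>y\<in>Y. ?sat y B)"
      if x: "(w, x) \<in> tree_R F G" "?sat x A" for x
    proof -
      obtain D C s where xs: "x = w @ (D, C) # s" "x \<in> worlds F G"
        using x(1) by (auto simp: tree_R_def)
      then have "critical (label G w) C (label G x)" using critical_label[OF G] by simp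
      then have *: "B \<^bold>\<rhd> C \<notin> label G w"
        using critical_rhd_transfer[OF M mcs_label[OF G xs(2)] _ AB] IH(1)[OF xs(2)] x(2) by simp
      \<comment> \<open>The witness takes over the index \<open>C\<close> of \<open>x\<close>, so
        that \<open>tree_S\<close> relates the two at \<open>w\<close>.\<close>
      let ?y = "w @ [(B, C)]"
      have y: "?y \<in> worlds F G" using Rhd.prems * by (auto intro: worlds.step)
      then have "(w, x, {?y}) \<in> tree_S F G" using xs by (auto simp: tree_S_def)
      moreover have "?sat ?y B" using IH(2)[OF y] crit_succ(3)[OF M *] by simp
      ultimately show ?thesis by blast
    qed
    then show "?sat w (A \<^bold>\<rhd> B)" by simp
  next
    assume sat: "?sat w (A \<^bold>\<rhd> B)"
    show "A \<^bold>\<rhd> B \<in> label G w"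
    proof (rule ccontr)
      let ?x = "w @ [(A, B)]"
      assume AB: "A \<^bold>\<rhd> B \<notin> label G w"
      then have x: "?x \<in> worlds F G" using Rhd.prems by (auto intro: worlds.step)
      then have "(w, ?x) \<in> tree_R F G" by (auto simp: tree_R_def)
      moreover have "?sat ?x A" using IH(1)[OF x] crit_succ(3)[OF M AB] by simp
      ultimately obtain Y where Y: "(w, ?x, Y) \<in> tree_S F G" "\<forall>y\<in>Y. ?sat y B"
        using sat by auto
      then obtain B' t where y: "Y = {w @ (B', B) # t}" "w @ (B', B) # t \<in> worlds F G"
        by (auto simp: tree_S_def)
      \<comment> \<open>Every set related to \<open>?x\<close> at \<open>w\<close> consists of a
        world with index \<open>B\<close>; its label is \<open>B\<close>-critical and so contains
        \<open>\<not> B\<close>.\<close>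
      have "B \<^bold>\<rhd> B \<in> label G w"
        by (rule theory_rhd_taut[OF mcs_closed_theory[OF M]]) (simp add: tautology_def)
      then have "\<^bold>\<not> B \<in> label G (w @ (B', B) # t)"
        using critical_label[OF G y(2)] unfolding critical_def by blast
      then show False using Y(2) y IH(2) mcs_Neg[OF mcs_label[OF G y(2)]] by simp
    qed
  qed
qed

section \<open>Transport along an injection\<close>

text \<open>Validity is assumed only for frames on \<open>'w\<close>, while the tree consists of
  lists; an injection carries the countermodel over.\<close>

lemma ILset_model_image:
  assumes "ILset_model W R S forces" and e: "inj e"
  shows "ILset_model (e ` W) (map_prod e e ` R) (map_prod e (map_prod e (image e)) ` S)
    (\<lambda>w. forces (inv e w))"
proof -
  interpret ILset_model W R S forces by fact
  define W' where "W' = e ` W"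
  define R' where "R' = map_prod e e ` R"
  define S' where "S' = map_prod e (map_prod e (image e)) ` S"
  let ?forces = "\<lambda>w. forces (inv e w)"
  \<comment> \<open>By injectivity, relations issuing from \<open>e w\<close> are exactly the images
    of those issuing from \<open>w\<close>.\<close>
  have R: "(e w, x') \<in> R' \<longleftrightarrow> (\<exists>x. x' = e x \<and> (w, x) \<in> R)" for w x'
    by (auto simp: R'_def image_iff Bex_def inj_eq[OF e])
  have S: "(e w, x', Y') \<in> S' \<longleftrightarrow> (\<exists>x Y. x' = e x \<and> Y' = e ` Y \<and> (w, x, Y) \<in> S)" for w x' Y'
    by (auto simp: S'_def image_iff Bex_def inj_eq[OF e])
  have R_I: "(e w, e x) \<in> R'" if "(w, x) \<in> R" for w x
    using that R by blast
  have S_I: "(e w, e x, e ` Y) \<in> S'" if "(w, x, Y) \<in> S" for w x Y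
    using that S by blast
  have R_dest: "\<exists>w x. w' = e w \<and> x' = e x \<and> (w, x) \<in> R" if "(w', x') \<in> R'" for w' x'
    using that by (auto simp: R'_def)
  have S_dest: "\<exists>w x Y. w' = e w \<and> x' = e x \<and> Y' = e ` Y \<and> (w, x, Y) \<in> S"
    if "(w', x', Y') \<in> S'" for w' x' Y'
    using that by (auto simp: S'_def image_iff Bex_def)
  have "ILset_model W' R' S' ?forces"
  proof
    show "W' \<noteq> {}" using W_nonempty by (simp add: W'_def)
    show "R' \<subseteq> W' \<times> W'" using R_sub by (auto simp: R'_def W'_def)
    show "trans R'"
    proof (rule transI)
      fix x y z assume xy: "(x, y) \<in> R'" and yz: "(y, z) \<in> R'"
      obtain x0 y0 where 1: "x = e x0" "y = e y0" "(x0, y0) \<in> R" using R_dest[OF xy] by blast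
      obtain z0 where 2: "z = e z0" "(y0, z0) \<in> R" using yz unfolding 1(2) R by blast
      have "(x0, z0) \<in> R" using transD[OF R_trans 1(3) 2(2)] .
      then show "(x, z) \<in> R'" unfolding 1(1) 2(1) by (rule R_I)
    qed
    show "\<exists>m\<in>X. \<forall>y\<in>X. (m, y) \<notin> R'" if X: "X \<subseteq> W'" "X \<noteq> {}" for X
    proof -
      obtain X0 where X0: "X0 \<subseteq> W" "X = e ` X0" using X(1) by (auto simp: W'_def subset_image_iff)
      then obtain m where "m \<in> X0" "\<forall>y\<in>X0. (m, y) \<notin> R" using R_conv_wf X(2) by blast
      then have "\<forall>y\<in>X. (e m, y) \<notin> R'" using X0(2) by (auto simp: R inj_eq[OF e])
      then show ?thesis using \<open>m \<in> X0\<close> X0(2) by blast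
    qed
    show "S' \<subseteq> W' \<times> W' \<times> (Pow W' - {{}})"
    proof (rule subsetI)
      fix p assume "p \<in> S'"
      then obtain w x Y where "p = (e w, e x, e ` Y)" "(w, x, Y) \<in> S" by (auto simp: S'_def)
      then show "p \<in> W' \<times> W' \<times> (Pow W' - {{}})" using S_sub unfolding W'_def by blast
    qed
    show "(w, x) \<in> R' \<and> (\<forall>y\<in>Y. (w, y) \<in> R')" if wxY: "(w, x, Y) \<in> S'" for w x Y
    proof -
      obtain w0 x0 Y0 where 1: "w = e w0" "x = e x0" "Y = e ` Y0" "(w0, x0, Y0) \<in> S"
        using S_dest[OF wxY] by blast
      then show ?thesis using S_R[OF 1(4)] by (auto intro: R_I)
    qed
    show "(w, x, {x}) \<in> S'" if wx: "(w, x) \<in> R'" for w x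
    proof -
      obtain w0 x0 where "w = e w0" "x = e x0" "(w0, x0, {x0}) \<in> S"
        using R_dest[OF wx] S_quasi_refl by blast
      then show ?thesis using S_I[of w0 x0 "{x0}"] by simp
    qed
    show "(w, x, Z) \<in> S'" if xY: "(w, x, Y) \<in> S'" "y \<in> Y" "y \<notin> Z" "(w, y, Z) \<in> S'" for w x Y y Z
    proof -
      obtain w0 x0 Y0 where 1: "w = e w0" "x = e x0" "Y = e ` Y0" "(w0, x0, Y0) \<in> S"
        using S_dest[OF xY(1)] by blast
      obtain y0 Z0 where 2: "y = e y0" "Z = e ` Z0" "(w0, y0, Z0) \<in> S"
        using xY(4) unfolding 1(1) S by blast
      have "y0 \<in> Y0" "y0 \<notin> Z0"
        using xY(2,3) unfolding 1(3) 2(1,2) inj_image_mem_iff[OF e] by simp_all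
      then have "(w0, x0, Z0) \<in> S" using S_quasi_trans[OF 1(4) _ _ 2(3)] by blast
      then show ?thesis unfolding 1(1,2) 2(2) by (rule S_I)
    qed
    show "(w, x, {y}) \<in> S'" if xy: "(w, x) \<in> R'" "(x, y) \<in> R'" for w x y
    proof -
      obtain w0 x0 where 1: "w = e w0" "x = e x0" "(w0, x0) \<in> R" using R_dest[OF xy(1)] by blast
      obtain y0 where 2: "y = e y0" "(x0, y0) \<in> R" using xy(2) unfolding 1(2) R by blast
      have "(w0, x0, {y0}) \<in> S" using R_S[OF 1(3) 2(2)] .
      then show ?thesis using S_I[of w0 x0 "{y0}"] 1 2 by simp
    qed
    fix w A B assume "w \<in> W'"
    then obtain w0 where w: "w = e w0" "w0 \<in> W" by (auto simp: W'_def)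
    show "\<not> ?forces w \<^bold>\<bottom>" using w forces_Falsum e by simp
    show "?forces w (A \<^bold>\<rightarrow> B) \<longleftrightarrow> (?forces w A \<longrightarrow> ?forces w B)" using w forces_Imp e by simp
    show "?forces w (\<^bold>\<box> A) \<longleftrightarrow> (\<forall>x. (w, x) \<in> R' \<longrightarrow> ?forces x A)"
      unfolding w(1) R inv_f_f[OF e] forces_Box[OF w(2)] by (auto simp: inv_f_f[OF e])
    show "?forces w (A \<^bold>\<rhd> B) \<longleftrightarrow>
      (\<forall>x. (w, x) \<in> R' \<longrightarrow> ?forces x A \<longrightarrow> (\<exists>Y. (w, x, Y) \<in> S' \<and> (\<forall>y\<in>Y. ?forces y B)))"
      (is "_ \<longleftrightarrow> ?rhs")
    proof -
      \<comment> \<open>The sets that \<open>S'\<close> relates to \<open>e x\<close> at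
        \<open>w\<close> are images under \<open>e\<close>, on which \<open>?forces\<close> reads
        back \<open>forces\<close>.\<close>
      have "(\<exists>Y. (w, e x, Y) \<in> S' \<and> (\<forall>y\<in>Y. ?forces y B)) \<longleftrightarrow>
          (\<exists>Y. (w0, x, Y) \<in> S \<and> (\<forall>y\<in>Y. forces y B))" (is "?l x \<longleftrightarrow> ?r x") for x
      proof
        assume "?l x"
        then obtain Y where "(w, e x, Y) \<in> S'" and B: "\<forall>y\<in>Y. ?forces y B" by blast
        then obtain Y0 where "Y = e ` Y0" "(w0, x, Y0) \<in> S"
          unfolding w(1) S inj_eq[OF e] by blast
        then show "?r x" using B inv_f_f[OF e] by auto
      next
        assume "?r x"
        then obtain Y where "(w0, x, Y) \<in> S" "\<forall>y\<in>Y. forces y B" by blast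
        moreover from this(1) have "(w, e x, e ` Y) \<in> S'" unfolding w(1) by (rule S_I)
        moreover from calculation(2) have "\<forall>y\<in>e ` Y. ?forces y B" by (simp add: inv_f_f[OF e])
        ultimately show "?l x" by blast
      qed
      moreover have "?rhs \<longleftrightarrow> (\<forall>x. (w0, x) \<in> R \<longrightarrow> forces x A \<longrightarrow>
          (\<exists>Y. (w, e x, Y) \<in> S' \<and> (\<forall>y\<in>Y. ?forces y B)))"
        unfolding w(1) R by (auto simp: inv_f_f[OF e])
      ultimately show ?thesis using forces_Rhd[OF w(2)] w(1) inv_f_f[OF e] by simp
    qed
  qed
  then show ?thesis by (simp add: W'_def R'_def S'_def)
qed

section \<open>Completeness\<close>

instance fm :: countable
  by countable_datatype

theorem theorem3p4:
  fixes A :: fm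
  assumes "infinite (UNIV :: 'w set)"
    and "\<And>(W :: 'w set) R S. ILset_frame W R S \<Longrightarrow> valid_on W R S A"
  shows "IL\<turnstile> A"
proof (rule ccontr)
  assume "A \<notin> IL"
  then obtain G where G: "mcs G" "A \<notin> G"
    using lindenbaum[OF closed_theory_IL] by blast
  define F where "F = requests A"
  let ?W = "worlds F G" and ?R = "tree_R F G" and ?S = "tree_S F G"
  let ?sat = "sat ?R ?S (\<lambda>w n. Var n \<in> label G w)"
  have "ILset_frame ?W ?R ?S"
    unfolding F_def by (rule tree_frame[OF G(1) finite_requests])
  then have model: "ILset_model ?W ?R ?S ?sat" by (rule ILset_frame.ILset_model_sat)
  obtain f :: "nat \<Rightarrow> 'w" where f: "inj f"
    using infinite_countable_subset[OF assms(1)] by blast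
  \<comment> \<open>Branches are coded by naturals, which embed into the infinite type
    \<open>'w\<close>.\<close>
  define e where "e = f \<circ> (to_nat :: (fm \<times> fm) list \<Rightarrow> nat)"
  have e: "inj e" unfolding e_def using f by (simp add: inj_compose)
  note model' = ILset_model_image[OF model e]
  \<comment> \<open>The transported model also certifies that its underlying structure is a frame,
    as the validity hypothesis requires.\<close>
  have "valid_on (e ` ?W) (map_prod e e ` ?R) (map_prod e (map_prod e (image e)) ` ?S) A"
    using assms(2) model' by (simp add: ILset_model_def)
  then have "?sat (inv e (e [])) A"
    using model' worlds.root unfolding valid_on_def by blast
  then have "?sat [] A" using e by simp
  then have "A \<in> label G []"
    using truth_lemma[OF G(1), of A F "[]"] worlds.root by (simp add: F_def)
  then show False using G(2) by simp
qed

end
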